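(* For any $n,m\ge1$, $\sigma\in S_n$ and $\tau\in S_m$, $$\{M_\sigma,M_\tau\}=\sum_{\zeta\in\mathrm{Sh}(n,m),\ \zeta\ne Z_{n,m}}M_{\zeta\cdot(\sigma/\tau)} .$$
   Context: $\Bbbk$ is a commutative ring. $\Bbbk S_n$ has basis $\{F_\sigma\}_{\sigma\in S_n}$; permutations are written as lists of values. Weak order and $M$ basis. $\mathrm{Inv}(\sigma)=\{(p,q):p<q,\ \sigma_p>\sigma_q\}$; $\sigma\le\tau$ in $S_n$ iff $\mathrm{Inv}(\sigma)\subseteq\mathrm{Inv}(\tau)$. With $\mu$ the Möbius function of this order, $M_\sigma:=\sum_{\sigma\le\tau}\mu(\sigma,\tau)F_\tau$. For $\sigma\in S_n,\tau\in S_m$, define in $S_{n+m}$ $$\sigma/\tau:=(\sigma_1,\dots,\sigma_n,\tau_1+n,\dots,\tau_m+n),\qquad \sigma\backslash\tau:=(\sigma_1+m,\dots,\sigma_n+m,\tau_1,\dots,\tau_m).$$ The bracket is the bilinear operation on $\bigoplus_{n\ge1}\Bbbk S_n$ given by $\{F_\sigma,F_\tau\}:=F_{\sigma/\tau}-F_{\sigma\backslash\tau}$. $\mathrm{Sh}(n,m)$ is the set of $\zeta\in S_{n+m}$ with $\zeta_1<\dots<\zeta_n$ and $\zeta_{n+1}<\dots<\zeta_{n+m}$. $Z_{n,m}:=1_n\backslash1_m=(m+1,\dots,m+n,1,\dots,m)\in S_{n+m}$, with $1_n$ the identity of $S_n$. The product $\zeta\cdot\pi$ is the usual composition of permutations,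 $(\zeta\cdot\pi)(j)=\zeta(\pi(j))$. *)

theory Defs
  imports "HOL-Library.Poly_Mapping" "HOL-Combinatorics.Combinatorics"
begin

(* S n: permutations of {1..n}, written as lists of values.  The length of the list
   records n, so that the sets S n are pairwise disjoint. *)
definition S :: "nat \<Rightarrow> nat list set" where
  "S n = permutations_of_set {1..n}"

(* The value sigma_p, with positions counted from 1. *)
definition entry :: "nat list \<Rightarrow> nat \<Rightarrow> nat" where
  "entry \<sigma> p = \<sigma> ! (p - 1)"

definition perm_id :: "nat \<Rightarrow> nat list" where
  "perm_id n = [1..<Suc n]"

(* (zeta . pi)(j) = zeta(pi(j)) *)
definition perm_comp :: "nat list \<Rightarrow> nat list \<Rightarrow> nat list" where
  "perm_comp \<zeta> \<pi> = map (entry \<zeta>) \<pi>"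

definition Inv :: "nat list \<Rightarrow> (nat \<times> nat) set" where
  "Inv \<sigma> = {(p, q). 1 \<le> p \<and> p < q \<and> q \<le> length \<sigma> \<and> entry \<sigma> p > entry \<sigma> q}"

definition weak_le :: "nat list \<Rightarrow> nat list \<Rightarrow> bool" where
  "weak_le \<sigma> \<tau> \<longleftrightarrow> (\<exists>n. \<sigma> \<in> S n \<and> \<tau> \<in> S n) \<and> Inv \<sigma> \<subseteq> Inv \<tau>"

definition weak_lt :: "nat list \<Rightarrow> nat list \<Rightarrow> bool" where
  "weak_lt \<sigma> \<tau> \<longleftrightarrow> weak_le \<sigma> \<tau> \<and> \<not> weak_le \<tau> \<sigma>"

lemma finite_Inv: "finite (Inv \<sigma>)"
  by (rule finite_subset[of _ "{..length \<sigma>} \<times> {..length \<sigma>}"]) (auto simp: Inv_def)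

lemma weak_lt_card: "weak_lt \<sigma> \<tau> \<Longrightarrow> card (Inv \<sigma>) < card (Inv \<tau>)"
  by (rule psubset_card_mono[OF finite_Inv]) (auto simp: weak_lt_def weak_le_def)

lemma finite_weak_le: "finite {\<tau>. weak_le \<sigma> \<tau>}"
proof (rule finite_subset)
  show "{\<tau>. weak_le \<sigma> \<tau>} \<subseteq> S (length \<sigma>)"
    by (auto simp: weak_le_def S_def length_finite_permutations_of_set)
  show "finite (S (length \<sigma>))"
    by (simp add: S_def)
qed

(* The Moebius function of the weak order:
   mu(sigma,sigma) = 1 and the sum of mu(sigma,rho) over sigma <= rho <= tau vanishes
   for sigma < tau; it is 0 off the order relation. *)
function weak_mu :: "nat list \<Rightarrow> nat list \<Rightarrow> int" where
  "weak_mu \<sigma> \<tau> =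
     (if \<sigma> = \<tau> then 1
      else if weak_le \<sigma> \<tau>
        then - (\<Sum>\<rho> \<in> {\<rho>. weak_le \<sigma> \<rho> \<and> weak_lt \<rho> \<tau>}. weak_mu \<sigma> \<rho>)
      else 0)"
  by auto
termination
  by (relation "measure (\<lambda>(\<sigma>, \<tau>). card (Inv \<tau>))") (auto dest: weak_lt_card)

declare weak_mu.simps [simp del]

(* The direct sum of the modules k S_n is realised inside the free module
   nat list =>_0 'k; the basis elements F sigma with sigma in S n, n >= 1, span it,
   and lists that are not permutations play no role. *)
definition F :: "nat list \<Rightarrow> (nat list \<Rightarrow>\<^sub>0 'k::comm_ring_1)" where
  "F \<sigma> = Poly_Mapping.single \<sigma> 1"

definition smult :: "'k::comm_ring_1 \<Rightarrow> (nat list \<Rightarrow>\<^sub>0 'k) \<Rightarrow> (nat list \<Rightarrow>\<^sub>0 'k)" where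
  "smult c x = Poly_Mapping.map (\<lambda>a. c * a) x"

definition M :: "nat list \<Rightarrow> (nat list \<Rightarrow>\<^sub>0 'k::comm_ring_1)" where
  "M \<sigma> = (\<Sum>\<tau> \<in> {\<tau>. weak_le \<sigma> \<tau>}. smult (of_int (weak_mu \<sigma> \<tau>)) (F \<tau>))"

(* over sigma tau is sigma/tau, and under sigma tau is sigma\tau. *)
definition over :: "nat list \<Rightarrow> nat list \<Rightarrow> nat list" where
  "over \<sigma> \<tau> = \<sigma> @ map (\<lambda>v. v + length \<sigma>) \<tau>"

definition under :: "nat list \<Rightarrow> nat list \<Rightarrow> nat list" where
  "under \<sigma> \<tau> = map (\<lambda>v. v + length \<tau>) \<sigma> @ \<tau>"

(* The bilinear extension of {F sigma, F tau} = F (sigma/tau) - F (sigma\tau);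
   see bracket_F and the linearity lemmas below. *)
definition bracket ::
    "(nat list \<Rightarrow>\<^sub>0 'k::comm_ring_1) \<Rightarrow> (nat list \<Rightarrow>\<^sub>0 'k) \<Rightarrow> (nat list \<Rightarrow>\<^sub>0 'k)" where
  "bracket x y =
     (\<Sum>\<sigma> \<in> Poly_Mapping.keys x. \<Sum>\<tau> \<in> Poly_Mapping.keys y.
        smult (Poly_Mapping.lookup x \<sigma> * Poly_Mapping.lookup y \<tau>)
          (F (over \<sigma> \<tau>) - F (under \<sigma> \<tau>)))"

definition Sh :: "nat \<Rightarrow> nat \<Rightarrow> nat list set" where
  "Sh n m = {\<zeta> \<in> S (n + m). sorted_wrt (<) (take n \<zeta>) \<and> sorted_wrt (<) (drop n \<zeta>)}"

definition Z :: "nat \<Rightarrow> nat \<Rightarrow> nat list" where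
  "Z n m = under (perm_id n) (perm_id m)"

lemma lookup_smult: "Poly_Mapping.lookup (smult c x) k = c * Poly_Mapping.lookup x k"
  unfolding smult_def by (simp add: Poly_Mapping.map.rep_eq when_def)

lemma smult_zero_left [simp]: "smult 0 x = 0"
  by (rule poly_mapping_eqI) (simp add: lookup_smult)

lemma smult_one_left [simp]: "smult 1 x = x"
  by (rule poly_mapping_eqI) (simp add: lookup_smult)

lemma smult_zero_right [simp]: "smult c 0 = 0"
  by (rule poly_mapping_eqI) (simp add: lookup_smult)

lemma smult_add_left: "smult (a + b) x = smult a x + smult b x"
  by (rule poly_mapping_eqI) (simp add: lookup_smult lookup_add algebra_simps)

lemma smult_add_right: "smult c (x + y) = smult c x + smult c y"
  by (rule poly_mapping_eqI) (simp add: lookup_smult lookup_add algebra_simps)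

lemma smult_smult: "smult a (smult b x) = smult (a * b) x"
  by (rule poly_mapping_eqI) (simp add: lookup_smult algebra_simps)

lemma smult_sum: "smult c (sum f A) = (\<Sum>i\<in>A. smult c (f i))"
  by (induction A rule: infinite_finite_induct) (simp_all add: smult_add_right)

lemma bracket_supset:
  assumes "finite A" "finite B" "Poly_Mapping.keys x \<subseteq> A" "Poly_Mapping.keys y \<subseteq> B"
  shows "bracket x y =
     (\<Sum>\<sigma> \<in> A. \<Sum>\<tau> \<in> B.
        smult (Poly_Mapping.lookup x \<sigma> * Poly_Mapping.lookup y \<tau>)
          (F (over \<sigma> \<tau>) - F (under \<sigma> \<tau>)))"
proof -
  have "bracket x y = (\<Sum>\<sigma> \<in> Poly_Mapping.keys x. \<Sum>\<tau> \<in> B.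
        smult (Poly_Mapping.lookup x \<sigma> * Poly_Mapping.lookup y \<tau>)
          (F (over \<sigma> \<tau>) - F (under \<sigma> \<tau>)))"
    unfolding bracket_def using assms
    by (intro sum.cong refl sum.mono_neutral_left) (auto simp: in_keys_iff)
  also have "\<dots> = (\<Sum>\<sigma> \<in> A. \<Sum>\<tau> \<in> B.
        smult (Poly_Mapping.lookup x \<sigma> * Poly_Mapping.lookup y \<tau>)
          (F (over \<sigma> \<tau>) - F (under \<sigma> \<tau>)))"
    using assms by (intro sum.mono_neutral_left) (auto simp: in_keys_iff)
  finally show ?thesis .
qed

lemma bracket_F: "bracket (F \<sigma>) (F \<tau>) = F (over \<sigma> \<tau>) - F (under \<sigma> \<tau>)"
  by (subst bracket_supset[of "{\<sigma>}" "{\<tau>}"]) (auto simp: F_def)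

lemma bracket_add_left: "bracket (x + x') y = bracket x y + bracket x' y"
proof -
  let ?A = "Poly_Mapping.keys x \<union> Poly_Mapping.keys x'"
  have "Poly_Mapping.keys (x + x') \<subseteq> ?A"
    by (rule keys_add)
  then show ?thesis
    by (simp add: bracket_supset[of ?A "Poly_Mapping.keys y"] lookup_add distrib_right
        smult_add_left sum.distrib)
qed

lemma bracket_add_right: "bracket x (y + y') = bracket x y + bracket x y'"
proof -
  let ?B = "Poly_Mapping.keys y \<union> Poly_Mapping.keys y'"
  have "Poly_Mapping.keys (y + y') \<subseteq> ?B"
    by (rule keys_add)
  then show ?thesis
    by (simp add: bracket_supset[of "Poly_Mapping.keys x" ?B] lookup_add distrib_left
        smult_add_left sum.distrib)
qed

lemma keys_smult: "Poly_Mapping.keys (smult c x) \<subseteq> Poly_Mapping.keys x"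
  by (auto simp: in_keys_iff lookup_smult)

lemma bracket_smult_left: "bracket (smult c x) y = smult c (bracket x y)"
  using keys_smult[of c x]
  by (simp add: bracket_supset[of "Poly_Mapping.keys x" "Poly_Mapping.keys y"]
      lookup_smult smult_sum smult_smult mult.assoc)

lemma bracket_smult_right: "bracket x (smult c y) = smult c (bracket x y)"
  using keys_smult[of c y]
  by (simp add: bracket_supset[of "Poly_Mapping.keys x" "Poly_Mapping.keys y"]
      lookup_smult smult_sum smult_smult mult.left_commute)

end

theory Submission
  imports Defs
begin

text \<open>Every permutation \<open>\<rho>\<close> of \<open>n + m\<close> letters is \<open>\<zeta> \<cdot> (\<sigma>/\<tau>)\<close> for exactly one
  shuffle \<open>\<zeta>\<close> and permutations \<open>\<sigma>\<close>, \<open>\<tau>\<close> of \<open>n\<close> and \<open>m\<close> letters: the shuffle says which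
  values stand in the first \<open>n\<close> places, and \<open>\<sigma>\<close>, \<open>\<tau>\<close> are the relative orders of the first
  \<open>n\<close> and of the last \<open>m\<close> entries (\<open>bij_betw_shuffle_factorization\<close>). As inversions are
  pairs of positions, those of \<open>\<rho>\<close> are the inversions of \<open>\<sigma>\<close>, the shifted inversions of
  \<open>\<tau>\<close>, and some pairs with one position in each block. For \<open>\<alpha>/\<beta>\<close> there are no pairs of
  the last kind, and for \<open>\<alpha> \ \<beta>\<close> all of them occur, which forces the shuffle to be
  \<^term>\<open>Z n m\<close>. Hence \<open>\<alpha>/\<beta> \<le> \<rho>\<close> means \<open>\<alpha> \<le> \<sigma>\<close> and \<open>\<beta> \<le> \<tau>\<close>, and
  \<open>\<alpha> \ \<beta> \<le> \<rho>\<close> means the same together with \<open>\<zeta> = Z\<close>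
  (\<open>over_le_perm_comp_iff\<close>, \<open>under_le_perm_comp_iff\<close>).

  By Moebius inversion each \<^const>\<open>F\<close> is the sum of \<^const>\<open>M\<close> over an upper set of the weak order.
  Expanding the two terms of \<open>{F \<alpha>, F \<beta>}\<close> in this way, the second cancels the terms with
  \<open>\<zeta> = Z\<close> of the first, and what remains is the sum over all \<open>\<sigma> \<ge> \<alpha>\<close> and
  \<open>\<tau> \<ge> \<beta>\<close> of the right-hand side of the claim (\<open>bracket_F_eq_sum_M\<close>). Moebius inversion
  in each argument then gives \<open>{M \<sigma>, M \<tau>}\<close>.\<close>

section \<open>Lists of values as functions of the position\<close>

lemma entry_append_left: "1 \<le> i \<Longrightarrow> i \<le> length xs \<Longrightarrow> entry (xs @ ys) i = entry xs i"
  by (auto simp: entry_def nth_append)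

lemma entry_append_right: "1 \<le> j \<Longrightarrow> entry (xs @ ys) (length xs + j) = entry ys j"
  by (auto simp: entry_def nth_append)

lemma entry_map: "1 \<le> i \<Longrightarrow> i \<le> length xs \<Longrightarrow> entry (map f xs) i = f (entry xs i)"
  by (auto simp: entry_def)

lemma entry_upt: "1 \<le> i \<Longrightarrow> i < b \<Longrightarrow> entry [1..<b] i = i"
  by (auto simp: entry_def)

lemma list_eq_entryI:
  assumes "length xs = length ys" "\<And>i. 1 \<le> i \<Longrightarrow> i \<le> length xs \<Longrightarrow> entry xs i = entry ys i"
  shows "xs = ys"
proof (rule nth_equalityI)
  fix i assume "i < length xs"
  with assms(2)[of "Suc i"] show "xs ! i = ys ! i"
    by (simp add: entry_def)
qed (fact assms(1))

lemma bij_betw_entry: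
  assumes "distinct xs"
  shows "bij_betw (entry xs) {1..length xs} (set xs)"
proof -
  have "bij_betw (\<lambda>p. p - 1) {1..length xs} {..<length xs}"
    by (rule bij_betw_byWitness[where f' = Suc]) auto
  moreover have "bij_betw ((!) xs) {..<length xs} (set xs)"
    using assms by (intro bij_betw_nth) auto
  moreover have "entry xs = (!) xs \<circ> (\<lambda>p. p - 1)"
    by (auto simp: entry_def)
  ultimately show ?thesis
    by (metis bij_betw_trans)
qed

lemma in_S_iff: "\<sigma> \<in> S n \<longleftrightarrow> set \<sigma> = {1..n} \<and> distinct \<sigma>"
  by (auto simp: S_def permutations_of_set_def)

lemma length_S: "\<sigma> \<in> S n \<Longrightarrow> length \<sigma> = n"
  by (auto simp: in_S_iff dest: distinct_card)

lemma bij_betw_entry_S: "\<sigma> \<in> S n \<Longrightarrow> bij_betw (entry \<sigma>) {1..n} {1..n}"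
  using bij_betw_entry[of \<sigma>] length_S[of \<sigma> n] by (simp add: in_S_iff)

lemma entry_S_range:
  assumes "\<sigma> \<in> S n" "1 \<le> p" "p \<le> n"
  shows "1 \<le> entry \<sigma> p" "entry \<sigma> p \<le> n"
  using bij_betwE[OF bij_betw_entry_S[OF assms(1)]] assms by auto

lemma entry_S_eq_iff:
  assumes "\<sigma> \<in> S n" "1 \<le> p" "p \<le> n" "1 \<le> q" "q \<le> n"
  shows "entry \<sigma> p = entry \<sigma> q \<longleftrightarrow> p = q"
  using bij_betw_imp_inj_on[OF bij_betw_entry_S[OF assms(1)]] assms by (auto dest: inj_onD)

lemma finite_S: "finite (S n)"
  by (simp add: S_def)

section \<open>The weak order and its Moebius function\<close>

lemma entry_less_iff_Inv:
  assumes "\<sigma> \<in> S n" "1 \<le> p" "p \<le> n" "1 \<le> q" "q \<le> n"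
  shows "entry \<sigma> q < entry \<sigma> p \<longleftrightarrow> (p < q \<and> (p, q) \<in> Inv \<sigma>) \<or> (q < p \<and> (q, p) \<notin> Inv \<sigma>)"
  using assms length_S[OF assms(1)] entry_S_eq_iff[OF assms]
  by (auto simp: Inv_def)

text \<open>The value at a position is one more than the number of positions with smaller values,
  and the inversions decide all these comparisons.\<close>
lemma Inv_injective:
  assumes s: "\<sigma> \<in> S n" and t: "\<tau> \<in> S n" and eq: "Inv \<sigma> = Inv \<tau>"
  shows "\<sigma> = \<tau>"
proof -
  have val: "Suc (card {q \<in> {1..n}. entry \<rho> q < entry \<rho> p}) = entry \<rho> p"
    if r: "\<rho> \<in> S n" and p: "1 \<le> p" "p \<le> n" for \<rho> p
  proof -
    note b = bij_betw_entry_S[OF r]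
    let ?Q = "{q \<in> {1..n}. entry \<rho> q < entry \<rho> p}"
    have "entry \<rho> ` ?Q = {v \<in> entry \<rho> ` {1..n}. v < entry \<rho> p}"
      by auto
    also have "\<dots> = {1..<entry \<rho> p}"
      using entry_S_range[OF r p] bij_betw_imp_surj_on[OF b] by auto
    finally have "card (entry \<rho> ` ?Q) = entry \<rho> p - 1"
      by simp
    moreover have "card (entry \<rho> ` ?Q) = card ?Q"
      by (rule card_image) (rule inj_on_subset[OF bij_betw_imp_inj_on[OF b]], auto)
    ultimately show ?thesis
      using entry_S_range[OF r p] by simp
  qed
  show ?thesis
  proof (rule list_eq_entryI)
    fix p assume p: "1 \<le> p" "p \<le> length \<sigma>"
    with length_S[OF s] have p': "1 \<le> p" "p \<le> n" by auto
    have "{q \<in> {1..n}. entry \<sigma> q < entry \<sigma> p} = {q \<in> {1..n}. entry \<tau> q < entry \<tau> p}"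
      using entry_less_iff_Inv[OF s p'] entry_less_iff_Inv[OF t p'] eq by auto
    with val[OF s p'] val[OF t p'] show "entry \<sigma> p = entry \<tau> p"
      by simp
  qed (use s t in \<open>simp add: length_S\<close>)
qed

lemma weak_le_S: "weak_le \<sigma> \<tau> \<Longrightarrow> \<sigma> \<in> S n \<longleftrightarrow> \<tau> \<in> S n"
  by (auto simp: weak_le_def dest: length_S)

lemma weak_le_iff: "\<sigma> \<in> S n \<Longrightarrow> weak_le \<sigma> \<tau> \<longleftrightarrow> \<tau> \<in> S n \<and> Inv \<sigma> \<subseteq> Inv \<tau>"
  by (auto simp: weak_le_def dest: length_S)

lemma weak_le_refl: "\<sigma> \<in> S n \<Longrightarrow> weak_le \<sigma> \<sigma>"
  by (auto simp: weak_le_def)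

lemma weak_le_antisym: "weak_le \<sigma> \<tau> \<Longrightarrow> weak_le \<tau> \<sigma> \<Longrightarrow> \<sigma> = \<tau>"
  by (metis Inv_injective weak_le_S weak_le_def subset_antisym)

lemma weak_le_trans: "weak_le \<sigma> \<tau> \<Longrightarrow> weak_le \<tau> \<rho> \<Longrightarrow> weak_le \<sigma> \<rho>"
  by (metis weak_le_S weak_le_def subset_trans)

lemma finite_weak_interval: "finite {\<rho>. weak_le \<sigma> \<rho> \<and> P \<rho>}"
  by (rule finite_subset[OF _ finite_weak_le[of \<sigma>]]) auto

lemma sum_weak_mu_interval:
  assumes "weak_le \<sigma> \<tau>"
  shows "(\<Sum>\<rho> | weak_le \<sigma> \<rho> \<and> weak_le \<rho> \<tau>. weak_mu \<sigma> \<rho>) = (if \<sigma> = \<tau> then 1 else 0)"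
proof (cases "\<sigma> = \<tau>")
  case True
  with assms have "{\<rho>. weak_le \<sigma> \<rho> \<and> weak_le \<rho> \<tau>} = {\<sigma>}"
    using weak_le_antisym by blast
  with True show ?thesis by (simp add: weak_mu.simps)
next
  case False
  obtain n where t: "\<tau> \<in> S n"
    using assms by (auto simp: weak_le_def)
  have eq: "{\<rho>. weak_le \<sigma> \<rho> \<and> weak_le \<rho> \<tau>} = insert \<tau> {\<rho>. weak_le \<sigma> \<rho> \<and> weak_lt \<rho> \<tau>}"
    using assms weak_le_refl[OF t] weak_le_antisym by (auto simp: weak_lt_def)
  have "\<tau> \<notin> {\<rho>. weak_le \<sigma> \<rho> \<and> weak_lt \<rho> \<tau>}"
    by (auto simp: weak_lt_def)
  then show ?thesis
    unfolding eq using False assms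
    by (simp add: finite_weak_interval weak_mu.simps[of \<sigma> \<tau>])
qed

lemma smult_sum_left: "(\<Sum>i\<in>A. smult (f i) x) = smult (\<Sum>i\<in>A. f i) x"
  by (induction A rule: infinite_finite_induct) (simp_all add: smult_add_left)

text \<open>One half of Moebius inversion, the one that follows directly from the recursion for
  \<^const>\<open>weak_mu\<close>: after exchanging the sums, the coefficient of \<open>h \<rho>\<close> is the sum of
  the Moebius function over an interval.\<close>
lemma moebius_inversion:
  fixes h :: "nat list \<Rightarrow> (nat list \<Rightarrow>\<^sub>0 'k::comm_ring_1)"
  assumes s: "\<sigma> \<in> S n"
  shows "(\<Sum>\<tau> | weak_le \<sigma> \<tau>. smult (of_int (weak_mu \<sigma> \<tau>)) (\<Sum>\<rho> | weak_le \<tau> \<rho>. h \<rho>)) = h \<sigma>"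
proof -
  have "(\<Sum>\<tau> | weak_le \<sigma> \<tau>. smult (of_int (weak_mu \<sigma> \<tau>)) (\<Sum>\<rho> | weak_le \<tau> \<rho>. h \<rho>))
      = (\<Sum>\<tau> | weak_le \<sigma> \<tau>. \<Sum>\<rho> | weak_le \<tau> \<rho>. smult (of_int (weak_mu \<sigma> \<tau>)) (h \<rho>))"
    by (simp add: smult_sum)
  also have "\<dots> = (\<Sum>\<tau> | weak_le \<sigma> \<tau>. \<Sum>\<rho> | \<rho> \<in> {\<rho>. weak_le \<sigma> \<rho>} \<and> weak_le \<tau> \<rho>.
      smult (of_int (weak_mu \<sigma> \<tau>)) (h \<rho>))"
    by (intro sum.cong refl) (auto intro: weak_le_trans)
  also have "\<dots> = (\<Sum>\<rho> | weak_le \<sigma> \<rho>. \<Sum>\<tau> | \<tau> \<in> {\<tau>. weak_le \<sigma> \<tau>} \<and> weak_le \<tau> \<rho>.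
      smult (of_int (weak_mu \<sigma> \<tau>)) (h \<rho>))"
    by (rule sum.swap_restrict) (simp_all add: finite_weak_le)
  also have "\<dots> = (\<Sum>\<rho> | weak_le \<sigma> \<rho>. if \<sigma> = \<rho> then h \<rho> else 0)"
  proof (intro sum.cong refl)
    fix \<rho> assume "\<rho> \<in> {\<rho>. weak_le \<sigma> \<rho>}"
    then have "(\<Sum>\<tau> | weak_le \<sigma> \<tau> \<and> weak_le \<tau> \<rho>. weak_mu \<sigma> \<tau>) = (if \<sigma> = \<rho> then 1 else 0)"
      by (intro sum_weak_mu_interval) simp
    then show "(\<Sum>\<tau> | \<tau> \<in> {\<tau>. weak_le \<sigma> \<tau>} \<and> weak_le \<tau> \<rho>. smult (of_int (weak_mu \<sigma> \<tau>)) (h \<rho>))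
        = (if \<sigma> = \<rho> then h \<rho> else 0)"
      by (simp add: smult_sum_left of_int_sum[symmetric] del: of_int_sum)
  qed
  also have "\<dots> = h \<sigma>"
    using weak_le_refl[OF s] by (simp add: finite_weak_le)
  finally show ?thesis .
qed

text \<open>The other half of Moebius inversion. Both \<^const>\<open>F\<close> and the family of sums of
  \<^const>\<open>M\<close> over upper sets are turned into \<^const>\<open>M\<close> by the Moebius transform, and that
  transform is unitriangular, so the two families agree by induction from the top of the order.\<close>
lemma F_eq_sum_M:
  assumes "\<sigma> \<in> S n"
  shows "(F \<sigma> :: nat list \<Rightarrow>\<^sub>0 'k::comm_ring_1) = (\<Sum>\<tau> | weak_le \<sigma> \<tau>. M \<tau>)"
  using assms
  \<comment> \<open>The measure drops when \<open>\<sigma>\<close> goes up, because its lower set grows.\<close>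
proof (induction "card (S n) - card {\<rho>\<in>S n. weak_le \<rho> \<sigma>}" arbitrary: \<sigma> rule: less_induct)
  case less
  define G where "G = (\<lambda>\<sigma>. \<Sum>\<tau> | weak_le \<sigma> \<tau>. (M \<tau> :: nat list \<Rightarrow>\<^sub>0 'k))"
  let ?U = "{\<tau>. weak_le \<sigma> \<tau>}"
  let ?c = "\<lambda>\<tau>. of_int (weak_mu \<sigma> \<tau>) :: 'k"
  have split: "(\<Sum>\<tau>\<in>?U. smult (?c \<tau>) (f \<tau>)) = f \<sigma> + (\<Sum>\<tau>\<in>?U - {\<sigma>}. smult (?c \<tau>) (f \<tau>))"
    for f :: "nat list \<Rightarrow> (nat list \<Rightarrow>\<^sub>0 'k)"
    using weak_le_refl[OF less.prems]
    by (subst sum.remove[of _ \<sigma>]) (auto simp: finite_weak_le weak_mu.simps)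
  have IH: "F \<tau> = G \<tau>" if "\<tau> \<in> ?U - {\<sigma>}" for \<tau>
  proof -
    from that have le: "weak_le \<sigma> \<tau>" and ne: "\<tau> \<noteq> \<sigma>" by auto
    have t: "\<tau> \<in> S n" using weak_le_S[OF le] less.prems by simp
    have "{\<rho>\<in>S n. weak_le \<rho> \<sigma>} \<subset> {\<rho>\<in>S n. weak_le \<rho> \<tau>}"
      using le ne t weak_le_refl[OF t] weak_le_antisym weak_le_trans by blast
    then have "card {\<rho>\<in>S n. weak_le \<rho> \<sigma>} < card {\<rho>\<in>S n. weak_le \<rho> \<tau>}"
      by (intro psubset_card_mono) (auto simp: finite_S)
    moreover have "card {\<rho>\<in>S n. weak_le \<rho> \<tau>} \<le> card (S n)"
      by (intro card_mono) (auto simp: finite_S)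
    ultimately show ?thesis
      unfolding G_def by (intro less.hyps t) linarith
  qed
  have "(\<Sum>\<tau>\<in>?U. smult (?c \<tau>) (F \<tau>)) = (\<Sum>\<tau>\<in>?U. smult (?c \<tau>) (G \<tau>))"
    unfolding G_def moebius_inversion[OF less.prems, of M] by (simp add: M_def)
  then have "F \<sigma> + (\<Sum>\<tau>\<in>?U - {\<sigma>}. smult (?c \<tau>) (F \<tau>))
      = G \<sigma> + (\<Sum>\<tau>\<in>?U - {\<sigma>}. smult (?c \<tau>) (G \<tau>))"
    by (simp only: split)
  moreover have "(\<Sum>\<tau>\<in>?U - {\<sigma>}. smult (?c \<tau>) (F \<tau>)) = (\<Sum>\<tau>\<in>?U - {\<sigma>}. smult (?c \<tau>) (G \<tau>))"
    by (intro sum.cong refl) (simp add: IH)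
  ultimately show ?case
    by (simp add: G_def)
qed

section \<open>Factoring a permutation through a shuffle\<close>

lemma Sh_S: "\<zeta> \<in> Sh n m \<Longrightarrow> \<zeta> \<in> S (n + m)"
  by (simp add: Sh_def)

lemma Sh_less_iff_left:
  assumes z: "\<zeta> \<in> Sh n m" and "1 \<le> i" "i \<le> n" "1 \<le> j" "j \<le> n"
  shows "entry \<zeta> i < entry \<zeta> j \<longleftrightarrow> i < j"
proof -
  have "entry \<zeta> i < entry \<zeta> j" if "1 \<le> i" "i < j" "j \<le> n" for i j
  proof -
    have "take n \<zeta> ! (i - 1) < take n \<zeta> ! (j - 1)"
      using z that length_S[OF Sh_S[OF z]]
      by (intro sorted_wrt_nth_less[of "(<)" "take n \<zeta>"]) (auto simp: Sh_def)
    with that show ?thesis by (simp add: entry_def)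
  qed
  with assms show ?thesis by (metis less_asym nat_neq_iff)
qed

lemma Sh_less_iff_right:
  assumes z: "\<zeta> \<in> Sh n m" and "1 \<le> i" "i \<le> m" "1 \<le> j" "j \<le> m"
  shows "entry \<zeta> (n + i) < entry \<zeta> (n + j) \<longleftrightarrow> i < j"
proof -
  have "entry \<zeta> (n + i) < entry \<zeta> (n + j)" if "1 \<le> i" "i < j" "j \<le> m" for i j
  proof -
    have "drop n \<zeta> ! (i - 1) < drop n \<zeta> ! (j - 1)"
      using z that length_S[OF Sh_S[OF z]]
      by (intro sorted_wrt_nth_less[of "(<)" "drop n \<zeta>"]) (auto simp: Sh_def)
    with that length_S[OF Sh_S[OF z]] show ?thesis by (simp add: entry_def)
  qed
  with assms show ?thesis by (metis less_asym nat_neq_iff)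
qed

lemma perm_comp_over:
  "\<sigma> \<in> S n \<Longrightarrow> perm_comp \<zeta> (over \<sigma> \<tau>) = map (entry \<zeta>) \<sigma> @ map (\<lambda>v. entry \<zeta> (n + v)) \<tau>"
  by (simp add: perm_comp_def over_def length_S add.commute)

lemma entry_perm_comp_over_left:
  assumes "\<sigma> \<in> S n" "1 \<le> p" "p \<le> n"
  shows "entry (perm_comp \<zeta> (over \<sigma> \<tau>)) p = entry \<zeta> (entry \<sigma> p)"
  using assms by (simp add: perm_comp_over entry_append_left entry_map length_S)

lemma entry_perm_comp_over_right:
  assumes "\<sigma> \<in> S n" "\<tau> \<in> S m" "1 \<le> p" "p \<le> m"
  shows "entry (perm_comp \<zeta> (over \<sigma> \<tau>)) (n + p) = entry \<zeta> (n + entry \<tau> p)"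
proof -
  have "entry (map (entry \<zeta>) \<sigma> @ map (\<lambda>v. entry \<zeta> (n + v)) \<tau>) (length (map (entry \<zeta>) \<sigma>) + p)
      = entry \<zeta> (n + entry \<tau> p)"
    using assms by (subst entry_append_right) (simp_all add: entry_map length_S)
  then show ?thesis
    using assms by (simp add: perm_comp_over length_S)
qed

lemma over_in_S:
  assumes "\<sigma> \<in> S n" "\<tau> \<in> S m"
  shows "over \<sigma> \<tau> \<in> S (n + m)"
proof -
  have "(\<lambda>v. v + n) ` {1..m} = {n + 1..n + m}"
    by (simp add: add.commute)
  with assms show ?thesis
    using length_S[OF assms(1)] by (auto simp: in_S_iff over_def distinct_map inj_on_def)
qed

lemma perm_comp_in_S:
  assumes "\<zeta> \<in> S n" "\<pi> \<in> S n"
  shows "perm_comp \<zeta> \<pi> \<in> S n"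
  using assms bij_betw_entry_S[OF assms(1)]
  by (auto simp: in_S_iff perm_comp_def distinct_map bij_betw_def)

text \<open>A shuffle is increasing on each of its two blocks, so it changes no comparison
  inside a block; only the comparisons across the blocks depend on it.\<close>
lemma Inv_perm_comp_over:
  assumes z: "\<zeta> \<in> Sh n m" and s: "\<sigma> \<in> S n" and t: "\<tau> \<in> S m"
  shows "Inv (perm_comp \<zeta> (over \<sigma> \<tau>)) = Inv \<sigma> \<union> map_prod ((+) n) ((+) n) ` Inv \<tau> \<union>
    {(p, n + q) | p q. 1 \<le> p \<and> p \<le> n \<and> 1 \<le> q \<and> q \<le> m \<and>
       entry \<zeta> (n + entry \<tau> q) < entry \<zeta> (entry \<sigma> p)}"
    (is "?L = ?A \<union> ?B \<union> ?C")
proof -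
  let ?\<rho> = "perm_comp \<zeta> (over \<sigma> \<tau>)"
  have len: "length ?\<rho> = n + m"
    using s t by (simp add: perm_comp_over length_S)
  note ls = length_S[OF s] and lt = length_S[OF t]
  note l = entry_perm_comp_over_left[OF s, of _ \<zeta> \<tau>]
  note r = entry_perm_comp_over_right[OF s t, of _ \<zeta>]
  have left: "(p, q) \<in> ?L \<longleftrightarrow> (p, q) \<in> ?A" if "q \<le> n" for p q
    using that len ls entry_S_range[OF s, of p] entry_S_range[OF s, of q]
    by (auto simp: Inv_def l Sh_less_iff_left[OF z])
  have right: "(n + p, n + q) \<in> ?L \<longleftrightarrow> (p, q) \<in> Inv \<tau>" if "1 \<le> p" "1 \<le> q" for p q
    using that len lt entry_S_range[OF t, of p] entry_S_range[OF t, of q]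
    by (auto simp: Inv_def r Sh_less_iff_right[OF z])
  have mid: "(p, n + q) \<in> ?L \<longleftrightarrow> (p, n + q) \<in> ?C" if "1 \<le> p" "p \<le> n" "1 \<le> q" for p q
    using that len by (auto simp: Inv_def r l)
  have "(p, q) \<in> ?L \<longleftrightarrow> (p, q) \<in> ?A \<union> ?B \<union> ?C" for p q
  proof (cases "q \<le> n")
    case True
    then have "(p, q) \<notin> ?B" "(p, q) \<notin> ?C" by (auto simp: Inv_def)
    with left[OF True] show ?thesis by blast
  next
    case False
    define q' where "q' = q - n"
    have q: "q = n + q'" "1 \<le> q'" using False by (auto simp: q'_def)
    have nA: "(p, q) \<notin> ?A" using q ls by (auto simp: Inv_def)
    consider "p = 0" | "1 \<le> p" "p \<le> n" | "n < p" by linarith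
    then show ?thesis
    proof cases
      case 1
      then show ?thesis by (auto simp: Inv_def)
    next
      case 2
      then have "(p, q) \<notin> ?B" by (auto simp: Inv_def)
      with nA mid[OF 2 q(2), folded q(1)] show ?thesis
        by (simp only: Un_iff simp_thms)
    next
      case 3
      define p' where "p' = p - n"
      have p: "p = n + p'" "1 \<le> p'" using 3 by (auto simp: p'_def)
      have "(p, q) \<notin> ?C" using 3 by auto
      moreover have "(p, q) \<in> ?B \<longleftrightarrow> (p', q') \<in> Inv \<tau>"
        unfolding p q by force
      ultimately show ?thesis
        using nA right[OF p(2) q(2), folded p(1) q(1)] by (simp only: Un_iff simp_thms)
    qed
  qed
  then show ?thesis by auto
qed

text \<open>Surjectivity: the first \<open>n\<close> and the last \<open>m\<close> values of \<open>\<rho>\<close>, each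
  listed in increasing order, form the shuffle; the other two factors record at which
  places of these increasing lists the values of \<open>\<rho>\<close> stand.
  Injectivity: \<open>\<zeta>\<close> is recovered from \<open>\<rho>\<close> in this way, and it is injective as a function.\<close>
lemma bij_betw_shuffle_factorization:
  "bij_betw (\<lambda>(\<zeta>, \<sigma>, \<tau>). perm_comp \<zeta> (over \<sigma> \<tau>)) (Sh n m \<times> S n \<times> S m) (S (n + m))"
  unfolding bij_betw_def
proof
  have recover: "take n \<zeta> = sorted_list_of_set (set (take n (perm_comp \<zeta> (over \<sigma> \<tau>))))"
    "drop n \<zeta> = sorted_list_of_set (set (drop n (perm_comp \<zeta> (over \<sigma> \<tau>))))"
    if z: "\<zeta> \<in> Sh n m" and s: "\<sigma> \<in> S n" and t: "\<tau> \<in> S m" for \<zeta> \<sigma> \<tau>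
  proof -
    have len: "length \<zeta> = n + m" and dist: "distinct \<zeta>"
      using length_S[OF Sh_S[OF z]] Sh_S[OF z] by (auto simp: in_S_iff)
    have "bij_betw (entry (take n \<zeta>)) {1..n} (set (take n \<zeta>))"
      using bij_betw_entry[of "take n \<zeta>"] dist len by simp
    then have "set (take n \<zeta>) = entry (take n \<zeta>) ` set \<sigma>"
      using s by (simp add: bij_betw_def in_S_iff)
    also have "\<dots> = entry \<zeta> ` set \<sigma>"
      using s by (intro image_cong) (auto simp: in_S_iff entry_def)
    also have "\<dots> = set (take n (perm_comp \<zeta> (over \<sigma> \<tau>)))"
      using s by (simp add: perm_comp_over length_S)
    finally have A: "set (take n (perm_comp \<zeta> (over \<sigma> \<tau>))) = set (take n \<zeta>)" by simp
    have "bij_betw (entry (drop n \<zeta>)) {1..m} (set (drop n \<zeta>))"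
      using bij_betw_entry[of "drop n \<zeta>"] dist len by simp
    then have "set (drop n \<zeta>) = entry (drop n \<zeta>) ` set \<tau>"
      using t by (simp add: bij_betw_def in_S_iff)
    also have "\<dots> = (\<lambda>v. entry \<zeta> (n + v)) ` set \<tau>"
      using t len by (intro image_cong) (auto simp: in_S_iff entry_def)
    also have "\<dots> = set (drop n (perm_comp \<zeta> (over \<sigma> \<tau>)))"
      using s by (simp add: perm_comp_over length_S)
    finally have B: "set (drop n (perm_comp \<zeta> (over \<sigma> \<tau>))) = set (drop n \<zeta>)" by simp
    have "sorted_wrt (<) (take n \<zeta>)" "sorted_wrt (<) (drop n \<zeta>)"
      using z by (auto simp: Sh_def)
    then show "take n \<zeta> = sorted_list_of_set (set (take n (perm_comp \<zeta> (over \<sigma> \<tau>))))"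
      "drop n \<zeta> = sorted_list_of_set (set (drop n (perm_comp \<zeta> (over \<sigma> \<tau>))))"
      unfolding A B by (simp_all add: sorted_list_of_set.idem_if_sorted_distinct strict_sorted_iff)
  qed
  show "inj_on (\<lambda>(\<zeta>, \<sigma>, \<tau>). perm_comp \<zeta> (over \<sigma> \<tau>)) (Sh n m \<times> S n \<times> S m)"
  proof (rule inj_onI, clarsimp)
    fix \<zeta> \<sigma> \<tau> \<zeta>' \<sigma>' \<tau>'
    assume z: "\<zeta> \<in> Sh n m" "\<zeta>' \<in> Sh n m" and s: "\<sigma> \<in> S n" "\<sigma>' \<in> S n"
      and t: "\<tau> \<in> S m" "\<tau>' \<in> S m"
      and eq: "perm_comp \<zeta> (over \<sigma> \<tau>) = perm_comp \<zeta>' (over \<sigma>' \<tau>')"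
    have zz: "\<zeta> = \<zeta>'"
      using recover[OF z(1) s(1) t(1)] recover[OF z(2) s(2) t(2)] eq
      by (metis append_take_drop_id)
    have "inj_on (entry \<zeta>) (set (over \<sigma> \<tau>) \<union> set (over \<sigma>' \<tau>'))"
      using bij_betw_entry_S[OF Sh_S[OF z(1)]] over_in_S[OF s(1) t(1)] over_in_S[OF s(2) t(2)]
      by (simp add: in_S_iff bij_betw_def)
    then have "over \<sigma> \<tau> = over \<sigma>' \<tau>'"
      using eq unfolding zz perm_comp_def by (simp add: inj_on_map_eq_map)
    then show "\<zeta> = \<zeta>' \<and> \<sigma> = \<sigma>' \<and> \<tau> = \<tau>'"
      using zz s by (simp add: over_def length_S inj_map_eq_map inj_on_def)
  qed
  show "(\<lambda>(\<zeta>, \<sigma>, \<tau>). perm_comp \<zeta> (over \<sigma> \<tau>)) ` (Sh n m \<times> S n \<times> S m) = S (n + m)"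
  proof (intro equalityI subsetI)
    fix \<rho> assume "\<rho> \<in> (\<lambda>(\<zeta>, \<sigma>, \<tau>). perm_comp \<zeta> (over \<sigma> \<tau>)) ` (Sh n m \<times> S n \<times> S m)"
    then show "\<rho> \<in> S (n + m)"
      by (auto intro!: perm_comp_in_S over_in_S dest: Sh_S)
  next
    fix \<rho> assume r: "\<rho> \<in> S (n + m)"
    let ?A = "set (take n \<rho>)" and ?B = "set (drop n \<rho>)"
    let ?a = "sorted_list_of_set ?A" and ?b = "sorted_list_of_set ?B"
    have dist: "distinct \<rho>" and set: "set \<rho> = {1..n+m}" and len: "length \<rho> = n + m"
      using r length_S[OF r] by (auto simp: in_S_iff)
    have la: "length ?a = n" and lb: "length ?b = m"
      using dist len by (simp_all add: distinct_card)
    have "?A \<inter> ?B = {}" using dist by (simp add: set_take_disj_set_drop_if_distinct)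
    moreover have "?A \<union> ?B = {1..n+m}" using set by (metis append_take_drop_id set_append)
    ultimately have z: "?a @ ?b \<in> Sh n m"
      using la lb by (auto simp: Sh_def in_S_iff)
    define a b where "a = inv_into {1..n} (entry ?a)" and "b = inv_into {1..m} (entry ?b)"
    have ba: "bij_betw (entry ?a) {1..n} ?A" and bb: "bij_betw (entry ?b) {1..m} ?B"
      using bij_betw_entry[of ?a] bij_betw_entry[of ?b] la lb by simp_all
    have ba': "bij_betw a ?A {1..n}" and bb': "bij_betw b ?B {1..m}"
      unfolding a_def b_def using ba bb by (auto intro: bij_betw_inv_into)
    have s: "map a (take n \<rho>) \<in> S n" and t: "map b (drop n \<rho>) \<in> S m"
      using ba' bb' dist by (auto simp: in_S_iff bij_betw_def distinct_map)
    have 1: "entry (?a @ ?b) (a v) = v" if "v \<in> ?A" for v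
      using bij_betwE[OF ba'] that la bij_betw_inv_into_right[OF ba that]
      by (subst entry_append_left) (auto simp: a_def)
    have 2: "entry (?a @ ?b) (n + b v) = v" if "v \<in> ?B" for v
      using entry_append_right[of "b v" ?a ?b] bij_betwE[OF bb'] that la
        bij_betw_inv_into_right[OF bb that] by (auto simp: b_def)
    have "perm_comp (?a @ ?b) (over (map a (take n \<rho>)) (map b (drop n \<rho>)))
        = map id (take n \<rho>) @ map id (drop n \<rho>)"
      unfolding perm_comp_over[OF s] map_map
      by (intro arg_cong2[where f = "(@)"] map_cong refl) (auto simp: 1 2)
    then have "\<rho> = perm_comp (?a @ ?b) (over (map a (take n \<rho>)) (map b (drop n \<rho>)))"
      by simp
    then show "\<rho> \<in> (\<lambda>(\<zeta>, \<sigma>, \<tau>). perm_comp \<zeta> (over \<sigma> \<tau>)) ` (Sh n m \<times> S n \<times> S m)"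
      using z s t by (intro image_eqI[of _ _ "(?a @ ?b, map a (take n \<rho>), map b (drop n \<rho>))"]) auto
  qed
qed

section \<open>The upper sets of the two concatenations\<close>

lemma length_perm_id [simp]: "length (perm_id n) = n"
  by (simp add: perm_id_def del: upt_Suc)

lemma perm_id_in_Sh: "perm_id (n + m) \<in> Sh n m"
  by (auto simp: Sh_def perm_id_def in_S_iff sorted_wrt_take sorted_wrt_drop simp del: upt_Suc)

lemma Z_in_Sh: "Z n m \<in> Sh n m"
proof -
  have "(\<lambda>v. v + m) ` {1..n} = {m + 1..m + n}"
    by (simp add: add.commute)
  then show ?thesis
    by (auto simp: Z_def under_def Sh_def perm_id_def in_S_iff distinct_map sorted_wrt_map
        atLeastLessThanSuc_atLeastAtMost simp del: upt_Suc)
qed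

lemma entry_perm_id: "1 \<le> i \<Longrightarrow> i \<le> n \<Longrightarrow> entry (perm_id n) i = i"
  unfolding perm_id_def by (rule entry_upt) auto

lemma entry_Z_left: "1 \<le> i \<Longrightarrow> i \<le> n \<Longrightarrow> entry (Z n m) i = i + m"
  unfolding Z_def under_def
  by (subst entry_append_left) (auto simp: entry_map entry_perm_id)

lemma entry_Z_right: "1 \<le> j \<Longrightarrow> j \<le> m \<Longrightarrow> entry (Z n m) (n + j) = j"
  using entry_append_right[of j "map (\<lambda>v. v + m) (perm_id n)" "perm_id m"]
  by (simp add: Z_def under_def entry_perm_id)

text \<open>Exchanging the two blocks of \<open>\<zeta>\<close> gives an increasing list, hence the identity.\<close>
lemma Sh_eq_Z:
  assumes z: "\<zeta> \<in> Sh n m"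
    and gt: "\<And>i j. 1 \<le> i \<Longrightarrow> i \<le> n \<Longrightarrow> 1 \<le> j \<Longrightarrow> j \<le> m \<Longrightarrow> entry \<zeta> (n + j) < entry \<zeta> i"
  shows "\<zeta> = Z n m"
proof -
  have len: "length \<zeta> = n + m" using length_S[OF Sh_S[OF z]] .
  have cross: "x < y" if x: "x \<in> set (drop n \<zeta>)" and y: "y \<in> set (take n \<zeta>)" for x y
  proof -
    obtain j where j: "x = \<zeta> ! (n + j)" "j < m"
      using x len unfolding in_set_conv_nth by auto
    obtain i where i: "y = \<zeta> ! i" "i < n"
      using y len unfolding in_set_conv_nth by auto
    show ?thesis using gt[of "Suc i" "Suc j"] i j by (simp add: entry_def)
  qed
  have "sorted_wrt (<) (drop n \<zeta> @ take n \<zeta>)"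
    unfolding sorted_wrt_append using z cross unfolding Sh_def by blast
  moreover have "set (drop n \<zeta> @ take n \<zeta>) = set (perm_id (m + n))"
  proof -
    have "set (drop n \<zeta> @ take n \<zeta>) = set \<zeta>"
      using arg_cong[OF append_take_drop_id[of n \<zeta>], of set] unfolding set_append by blast
    also have "\<dots> = set (perm_id (m + n))"
      using Sh_S[OF z] by (auto simp: in_S_iff perm_id_def simp del: upt_Suc)
    finally show ?thesis .
  qed
  moreover have "sorted_wrt (<) (perm_id (m + n))"
    by (simp add: perm_id_def del: upt_Suc)
  ultimately have eq: "drop n \<zeta> @ take n \<zeta> = perm_id (m + n)"
    by (metis strict_sorted_equal)
  have "perm_id (m + n) = perm_id m @ map (\<lambda>v. v + m) (perm_id n)"
  proof (rule list_eq_entryI)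
    fix i assume i: "1 \<le> i" "i \<le> length (perm_id (m + n))"
    then have i': "i \<le> m + n" by simp
    show "entry (perm_id (m + n)) i = entry (perm_id m @ map (\<lambda>v. v + m) (perm_id n)) i"
    proof (cases "i \<le> m")
      case True
      with i i' show ?thesis
        by (subst entry_append_left) (auto simp: entry_perm_id)
    next
      case False
      with i i' entry_append_right[of "i - m" "perm_id m" "map (\<lambda>v. v + m) (perm_id n)"]
      show ?thesis
        by (simp add: entry_perm_id entry_map)
    qed
  qed simp
  with eq have "drop n \<zeta> @ take n \<zeta> = perm_id m @ map (\<lambda>v. v + m) (perm_id n)"
    by simp
  then have "drop n \<zeta> = perm_id m" "take n \<zeta> = map (\<lambda>v. v + m) (perm_id n)"
    using len by (simp_all add: append_eq_append_conv)
  then have "take n \<zeta> @ drop n \<zeta> = map (\<lambda>v. v + m) (perm_id n) @ perm_id m"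
    by (simp only:)
  then show ?thesis
    unfolding Z_def under_def append_take_drop_id by simp
qed

text \<open>Both concatenations are themselves of the form \<open>\<zeta> \<cdot> (\<sigma>/\<tau>)\<close>, with the two extreme
  shuffles, so the description of the inversions covers them as well.\<close>
lemma over_eq_perm_comp:
  assumes "\<sigma> \<in> S n" "\<tau> \<in> S m"
  shows "over \<sigma> \<tau> = perm_comp (perm_id (n + m)) (over \<sigma> \<tau>)"
proof -
  have "map (entry (perm_id (n + m))) (over \<sigma> \<tau>) = map id (over \<sigma> \<tau>)"
    using over_in_S[OF assms] by (intro map_cong refl) (auto simp: in_S_iff entry_perm_id)
  then show ?thesis by (simp add: perm_comp_def)
qed

lemma under_eq_perm_comp:
  assumes "\<sigma> \<in> S n" "\<tau> \<in> S m"
  shows "under \<sigma> \<tau> = perm_comp (Z n m) (over \<sigma> \<tau>)"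
proof -
  have "map (entry (Z n m)) \<sigma> = map (\<lambda>v. v + m) \<sigma>"
    "map (\<lambda>v. entry (Z n m) (n + v)) \<tau> = \<tau>"
    using assms by (auto simp: in_S_iff entry_Z_left entry_Z_right intro!: map_idI)
  then show ?thesis
    using assms by (simp add: perm_comp_over under_def length_S)
qed

lemma Inv_over:
  assumes "\<sigma> \<in> S n" "\<tau> \<in> S m"
  shows "Inv (over \<sigma> \<tau>) = Inv \<sigma> \<union> map_prod ((+) n) ((+) n) ` Inv \<tau>"
proof -
  have "\<not> entry (perm_id (n + m)) (n + entry \<tau> q) < entry (perm_id (n + m)) (entry \<sigma> p)"
    if "1 \<le> p" "p \<le> n" "1 \<le> q" "q \<le> m" for p q
    using entry_S_range[OF assms(1), of p] entry_S_range[OF assms(2), of q] that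
    by (simp add: entry_perm_id)
  then show ?thesis
    using Inv_perm_comp_over[OF perm_id_in_Sh assms] over_eq_perm_comp[OF assms] by auto
qed

lemma Inv_under:
  assumes "\<sigma> \<in> S n" "\<tau> \<in> S m"
  shows "Inv (under \<sigma> \<tau>) = Inv \<sigma> \<union> map_prod ((+) n) ((+) n) ` Inv \<tau> \<union>
    {(p, n + q) | p q. 1 \<le> p \<and> p \<le> n \<and> 1 \<le> q \<and> q \<le> m}"
proof -
  have "entry (Z n m) (n + entry \<tau> q) < entry (Z n m) (entry \<sigma> p)"
    if "1 \<le> p" "p \<le> n" "1 \<le> q" "q \<le> m" for p q
    using entry_S_range[OF assms(1), of p] entry_S_range[OF assms(2), of q] that
    by (simp add: entry_Z_left entry_Z_right)
  then show ?thesis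
    unfolding under_eq_perm_comp[OF assms] Inv_perm_comp_over[OF Z_in_Sh assms] by blast
qed

lemma over_le_perm_comp_iff:
  assumes z: "\<zeta> \<in> Sh n m" and a: "\<alpha> \<in> S n" and b: "\<beta> \<in> S m" and s: "\<sigma> \<in> S n" and t: "\<tau> \<in> S m"
  shows "weak_le (over \<alpha> \<beta>) (perm_comp \<zeta> (over \<sigma> \<tau>)) \<longleftrightarrow> weak_le \<alpha> \<sigma> \<and> weak_le \<beta> \<tau>"
proof -
  have A: "x \<in> Inv \<sigma>" if "x \<in> Inv \<alpha>" "x \<in> Inv (perm_comp \<zeta> (over \<sigma> \<tau>))" for x
    using that length_S[OF a] unfolding Inv_perm_comp_over[OF z s t] by (auto simp: Inv_def)
  have B: "x \<in> Inv \<tau>" if "x \<in> Inv \<beta>" "map_prod ((+) n) ((+) n) x \<in> Inv (perm_comp \<zeta> (over \<sigma> \<tau>))" for x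
    using that length_S[OF s] unfolding Inv_perm_comp_over[OF z s t] by (auto simp: Inv_def)
  have "Inv (over \<alpha> \<beta>) \<subseteq> Inv (perm_comp \<zeta> (over \<sigma> \<tau>)) \<longleftrightarrow> Inv \<alpha> \<subseteq> Inv \<sigma> \<and> Inv \<beta> \<subseteq> Inv \<tau>"
    (is "?L \<longleftrightarrow> ?R")
  proof
    assume ?L
    then show ?R using A B unfolding Inv_over[OF a b] by blast
  next
    assume ?R
    then show ?L unfolding Inv_over[OF a b] Inv_perm_comp_over[OF z s t] by blast
  qed
  then show ?thesis
    using perm_comp_in_S[OF Sh_S[OF z] over_in_S[OF s t]]
    by (simp add: weak_le_iff[OF over_in_S[OF a b]] weak_le_iff[OF a] weak_le_iff[OF b] s t)
qed

lemma under_le_perm_comp_iff: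
  assumes z: "\<zeta> \<in> Sh n m" and a: "\<alpha> \<in> S n" and b: "\<beta> \<in> S m" and s: "\<sigma> \<in> S n" and t: "\<tau> \<in> S m"
  shows "weak_le (under \<alpha> \<beta>) (perm_comp \<zeta> (over \<sigma> \<tau>)) \<longleftrightarrow>
    weak_le \<alpha> \<sigma> \<and> weak_le \<beta> \<tau> \<and> \<zeta> = Z n m"
proof -
  let ?X = "{(p, n + q) | p q. 1 \<le> p \<and> p \<le> n \<and> 1 \<le> q \<and> q \<le> m}"
  let ?\<rho> = "perm_comp \<zeta> (over \<sigma> \<tau>)"
  have u: "under \<alpha> \<beta> \<in> S (n + m)" and r: "?\<rho> \<in> S (n + m)"
    using under_eq_perm_comp[OF a b] perm_comp_in_S[OF Sh_S[OF Z_in_Sh] over_in_S[OF a b]]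
      perm_comp_in_S[OF Sh_S[OF z] over_in_S[OF s t]] by simp_all
  have "?X \<subseteq> Inv ?\<rho> \<longleftrightarrow> \<zeta> = Z n m"
  proof
    assume X: "?X \<subseteq> Inv ?\<rho>"
    show "\<zeta> = Z n m"
    proof (rule Sh_eq_Z[OF z])
      fix i j assume i: "1 \<le> i" "i \<le> n" and j: "1 \<le> j" "j \<le> m"
      have "i \<in> entry \<sigma> ` {1..n}"
        using bij_betw_imp_surj_on[OF bij_betw_entry_S[OF s]] i by simp
      then obtain p where p: "1 \<le> p" "p \<le> n" "entry \<sigma> p = i"
        by auto
      have "j \<in> entry \<tau> ` {1..m}"
        using bij_betw_imp_surj_on[OF bij_betw_entry_S[OF t]] j by simp
      then obtain q where q: "1 \<le> q" "q \<le> m" "entry \<tau> q = j"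
        by auto
      have "(p, n + q) \<in> Inv ?\<rho>" using X p q by blast
      then show "entry \<zeta> (n + j) < entry \<zeta> i"
        using p q by (simp add: Inv_def entry_perm_comp_over_left[OF s] entry_perm_comp_over_right[OF s t])
    qed
  next
    assume "\<zeta> = Z n m"
    then have "?\<rho> = under \<sigma> \<tau>" using under_eq_perm_comp[OF s t] by simp
    then show "?X \<subseteq> Inv ?\<rho>" by (simp add: Inv_under[OF s t])
  qed
  moreover have "Inv (under \<alpha> \<beta>) = Inv (over \<alpha> \<beta>) \<union> ?X"
    using Inv_under[OF a b] Inv_over[OF a b] by simp
  ultimately have "weak_le (under \<alpha> \<beta>) ?\<rho> \<longleftrightarrow> weak_le (over \<alpha> \<beta>) ?\<rho> \<and> \<zeta> = Z n m"
    using r by (simp add: weak_le_iff[OF u] weak_le_iff[OF over_in_S[OF a b]])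
  then show ?thesis by (simp add: over_le_perm_comp_iff[OF assms])
qed

section \<open>The bracket on the two bases\<close>

text \<open>Sums over a set of permutations of \<open>n + m\<close> letters, in the coordinates given by the
  factorization through shuffles; \<open>U\<close> will be an upper set of the weak order.\<close>
lemma sum_over_factorization:
  fixes f :: "nat list \<Rightarrow> 'a::comm_monoid_add"
  assumes "\<And>\<rho>. \<rho> \<in> U \<Longrightarrow> \<rho> \<in> S (n + m)" "Q \<subseteq> Sh n m \<times> S n \<times> S m"
    and "\<And>\<zeta> \<sigma> \<tau>. \<zeta> \<in> Sh n m \<Longrightarrow> \<sigma> \<in> S n \<Longrightarrow> \<tau> \<in> S m \<Longrightarrow>
      perm_comp \<zeta> (over \<sigma> \<tau>) \<in> U \<longleftrightarrow> (\<zeta>, \<sigma>, \<tau>) \<in> Q"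
  shows "(\<Sum>\<rho>\<in>U. f \<rho>) = (\<Sum>(\<zeta>, \<sigma>, \<tau>)\<in>Q. f (perm_comp \<zeta> (over \<sigma> \<tau>)))"
proof -
  let ?\<phi> = "\<lambda>(\<zeta>, \<sigma>, \<tau>). perm_comp \<zeta> (over \<sigma> \<tau>)"
  have img: "?\<phi> ` Q = U"
  proof (intro equalityI subsetI)
    fix \<rho> assume "\<rho> \<in> ?\<phi> ` Q"
    then show "\<rho> \<in> U" using assms(2,3) by fastforce
  next
    fix \<rho> assume r: "\<rho> \<in> U"
    then have "\<rho> \<in> ?\<phi> ` (Sh n m \<times> S n \<times> S m)"
      using assms(1) bij_betw_shuffle_factorization[of n m] by (simp add: bij_betw_def)
    with r show "\<rho> \<in> ?\<phi> ` Q" using assms(3) by force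
  qed
  have "inj_on ?\<phi> Q"
    using bij_betw_shuffle_factorization[of n m] assms(2) by (auto simp: bij_betw_def intro: inj_on_subset)
  with img have "bij_betw ?\<phi> Q U" by (simp add: bij_betw_def)
  from sum.reindex_bij_betw[OF this, of f] show ?thesis
    by (simp add: case_prod_unfold)
qed

text \<open>Expand both concatenations in the \<^const>\<open>M\<close> basis: the terms of the second are
  exactly the terms of the first with the shuffle \<^term>\<open>Z n m\<close>.\<close>
lemma bracket_F_eq_sum_M:
  assumes a: "\<alpha> \<in> S n" and b: "\<beta> \<in> S m"
  shows "bracket (F \<alpha>) (F \<beta>) = (\<Sum>\<sigma> | weak_le \<alpha> \<sigma>. \<Sum>\<tau> | weak_le \<beta> \<tau>.
    \<Sum>\<zeta> \<in> {\<zeta> \<in> Sh n m. \<zeta> \<noteq> Z n m}. (M (perm_comp \<zeta> (over \<sigma> \<tau>)) :: nat list \<Rightarrow>\<^sub>0 'k::comm_ring_1))"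
proof -
  let ?A = "{\<sigma>. weak_le \<alpha> \<sigma>}" and ?B = "{\<tau>. weak_le \<beta> \<tau>}"
  let ?f = "\<lambda>\<zeta> \<sigma> \<tau>. M (perm_comp \<zeta> (over \<sigma> \<tau>)) :: nat list \<Rightarrow>\<^sub>0 'k"
  let ?Sh' = "{\<zeta> \<in> Sh n m. \<zeta> \<noteq> Z n m}"
  have sub: "?A \<subseteq> S n" "?B \<subseteq> S m"
    by (auto simp: weak_le_iff[OF a] weak_le_iff[OF b])
  have u: "under \<alpha> \<beta> \<in> S (n + m)"
    using under_eq_perm_comp[OF a b] perm_comp_in_S[OF Sh_S[OF Z_in_Sh] over_in_S[OF a b]] by simp
  have up_over: "\<rho> \<in> S (n + m)" if "weak_le (over \<alpha> \<beta>) \<rho>" for \<rho>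
    using that by (simp add: weak_le_iff[OF over_in_S[OF a b]])
  have up_under: "\<rho> \<in> S (n + m)" if "weak_le (under \<alpha> \<beta>) \<rho>" for \<rho>
    using that by (simp add: weak_le_iff[OF u])
  have finSh: "finite (Sh n m)"
    by (rule finite_subset[OF _ finite_S]) (auto simp: Sh_def)
  have "F (over \<alpha> \<beta>) = (\<Sum>(\<zeta>, \<sigma>, \<tau>)\<in>Sh n m \<times> ?A \<times> ?B. ?f \<zeta> \<sigma> \<tau>)"
    unfolding F_eq_sum_M[OF over_in_S[OF a b]]
    by (rule sum_over_factorization)
      (use sub in \<open>auto simp: over_le_perm_comp_iff[OF _ a b] dest: up_over\<close>)
  also have "\<dots> = (\<Sum>\<zeta>\<in>Sh n m. \<Sum>\<sigma>\<in>?A. \<Sum>\<tau>\<in>?B. ?f \<zeta> \<sigma> \<tau>)"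
    by (simp add: sum.cartesian_product)
  also have "Sh n m = insert (Z n m) ?Sh'"
    using Z_in_Sh by auto
  also have "(\<Sum>\<zeta>\<in>insert (Z n m) ?Sh'. \<Sum>\<sigma>\<in>?A. \<Sum>\<tau>\<in>?B. ?f \<zeta> \<sigma> \<tau>) =
      (\<Sum>\<sigma>\<in>?A. \<Sum>\<tau>\<in>?B. ?f (Z n m) \<sigma> \<tau>) + (\<Sum>\<zeta>\<in>?Sh'. \<Sum>\<sigma>\<in>?A. \<Sum>\<tau>\<in>?B. ?f \<zeta> \<sigma> \<tau>)"
    using finSh by (subst sum.insert) auto
  finally have over: "F (over \<alpha> \<beta>) = \<dots>" .
  have "F (under \<alpha> \<beta>) = (\<Sum>(\<zeta>, \<sigma>, \<tau>)\<in>{Z n m} \<times> ?A \<times> ?B. ?f \<zeta> \<sigma> \<tau>)"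
    unfolding F_eq_sum_M[OF u]
    by (rule sum_over_factorization)
      (use sub in \<open>auto simp: under_le_perm_comp_iff[OF _ a b] Z_in_Sh dest: up_under\<close>)
  also have "\<dots> = (\<Sum>\<zeta>\<in>{Z n m}. \<Sum>\<sigma>\<in>?A. \<Sum>\<tau>\<in>?B. ?f \<zeta> \<sigma> \<tau>)"
    unfolding sum.cartesian_product by simp
  finally have under: "F (under \<alpha> \<beta>) = (\<Sum>\<sigma>\<in>?A. \<Sum>\<tau>\<in>?B. ?f (Z n m) \<sigma> \<tau>)"
    by simp
  have "bracket (F \<alpha>) (F \<beta>) = (\<Sum>\<zeta>\<in>?Sh'. \<Sum>\<sigma>\<in>?A. \<Sum>\<tau>\<in>?B. ?f \<zeta> \<sigma> \<tau>)"
    by (simp add: bracket_F over under)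
  also have "\<dots> = (\<Sum>\<sigma>\<in>?A. \<Sum>\<zeta>\<in>?Sh'. \<Sum>\<tau>\<in>?B. ?f \<zeta> \<sigma> \<tau>)"
    by (rule sum.swap)
  also have "\<dots> = (\<Sum>\<sigma>\<in>?A. \<Sum>\<tau>\<in>?B. \<Sum>\<zeta>\<in>?Sh'. ?f \<zeta> \<sigma> \<tau>)"
    by (rule sum.cong[OF refl], rule sum.swap)
  finally show ?thesis .
qed

lemma bracket_sum_left: "bracket (sum f A) y = (\<Sum>i\<in>A. bracket (f i) y)"
  by (induction A rule: infinite_finite_induct) (simp_all add: bracket_add_left, simp_all add: bracket_def)

lemma bracket_sum_right: "bracket x (sum f A) = (\<Sum>i\<in>A. bracket x (f i))"
  by (induction A rule: infinite_finite_induct) (simp_all add: bracket_add_right, simp_all add: bracket_def)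

theorem proposition5p1:
  fixes n m :: nat and \<sigma> \<tau> :: "nat list"
  assumes "n \<ge> 1" and "m \<ge> 1" and "\<sigma> \<in> S n" and "\<tau> \<in> S m"
  shows "bracket (M \<sigma>) (M \<tau>) =
    (\<Sum>\<zeta> \<in> {\<zeta> \<in> Sh n m. \<zeta> \<noteq> Z n m}.
       (M (perm_comp \<zeta> (over \<sigma> \<tau>)) :: nat list \<Rightarrow>\<^sub>0 'k::comm_ring_1))"
proof -
  define B where "B = (\<lambda>\<sigma> \<tau>. \<Sum>\<zeta> \<in> {\<zeta> \<in> Sh n m. \<zeta> \<noteq> Z n m}.
       (M (perm_comp \<zeta> (over \<sigma> \<tau>)) :: nat list \<Rightarrow>\<^sub>0 'k))"
  let ?\<mu> = "\<lambda>\<sigma> \<tau>. of_int (weak_mu \<sigma> \<tau>) :: 'k"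
  \<comment> \<open>Undo the sum over \<open>\<tau>' \<ge> \<beta>\<close> while \<open>F \<alpha>\<close> stays in the first argument.\<close>
  have half: "bracket (F \<alpha>) (M \<tau>) = (\<Sum>\<sigma>' | weak_le \<alpha> \<sigma>'. B \<sigma>' \<tau>)" if a: "\<alpha> \<in> S n" for \<alpha>
  proof -
    have "bracket (F \<alpha>) (M \<tau>) = (\<Sum>\<beta> | weak_le \<tau> \<beta>. smult (?\<mu> \<tau> \<beta>) (bracket (F \<alpha>) (F \<beta>)))"
      by (simp add: M_def bracket_sum_right bracket_smult_right)
    also have "\<dots> = (\<Sum>\<beta> | weak_le \<tau> \<beta>. smult (?\<mu> \<tau> \<beta>)
        (\<Sum>\<tau>' | weak_le \<beta> \<tau>'. \<Sum>\<sigma>' | weak_le \<alpha> \<sigma>'. B \<sigma>' \<tau>'))"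
    proof (intro sum.cong refl arg_cong[where f = "smult _"])
      fix \<beta> assume "\<beta> \<in> {\<beta>. weak_le \<tau> \<beta>}"
      then have "\<beta> \<in> S m" by (simp add: weak_le_iff[OF assms(4)])
      show "bracket (F \<alpha>) (F \<beta>) = (\<Sum>\<tau>' | weak_le \<beta> \<tau>'. \<Sum>\<sigma>' | weak_le \<alpha> \<sigma>'. B \<sigma>' \<tau>')"
        unfolding B_def by (rule trans[OF bracket_F_eq_sum_M[OF a \<open>\<beta> \<in> S m\<close>] sum.swap])
    qed
    also have "\<dots> = (\<Sum>\<sigma>' | weak_le \<alpha> \<sigma>'. B \<sigma>' \<tau>)"
      by (rule moebius_inversion[OF assms(4)])
    finally show ?thesis .
  qed
  have "bracket (M \<sigma>) (M \<tau>) = (\<Sum>\<alpha> | weak_le \<sigma> \<alpha>. smult (?\<mu> \<sigma> \<alpha>) (bracket (F \<alpha>) (M \<tau>)))"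
    by (simp add: M_def[of \<sigma>] bracket_sum_left bracket_smult_left)
  also have "\<dots> = (\<Sum>\<alpha> | weak_le \<sigma> \<alpha>. smult (?\<mu> \<sigma> \<alpha>) (\<Sum>\<sigma>' | weak_le \<alpha> \<sigma>'. B \<sigma>' \<tau>))"
    by (intro sum.cong refl arg_cong[where f = "smult _"] half) (simp add: weak_le_iff[OF assms(3)])
  also have "\<dots> = B \<sigma> \<tau>"
    by (rule moebius_inversion[OF assms(3)])
  finally show ?thesis
    by (simp add: B_def)
qed

end
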